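(* Let $K_n$ be the complete graph on $n$ vertices and let $H$ be a finite simple connected graph with $m$ vertices. Then $$Sz(K_n\wr H)=n^3m^{3n-3}Sz(H)+\frac12 m^n n(n-1)\Big(m+m^{n-2}\big(m^2+mn-3m-n+2\big)\Big)^2.$$
   Context: The wreath product $G\wr H$ has vertex set $\{(f,v): f:V_G\to V_H,\ v\in V_G\}$; $(f,v)$ and $(f',v')$ are adjacent iff either $v=v'$, $f(w)=f'(w)$ for $w\neq v$ and $f(v)\sim f'(v)$ in $H$, or $f=f'$ and $v\sim v'$ in $G$. For a connected graph $X$ and edge $e=\{u,v\}$, $n_u(e)=|\{w\in V_X:d_X(w,u)<d_X(w,v)\}|$ ($d_X$ geodesic distance), and the Szeged index is $Sz(X)=\sum_{e=\{u,v\}\in E_X}n_u(e)n_v(e)$. Throughout, $n\ge2$. *)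

theory Defs
  imports Complex_Main "HOL-Library.FuncSet"
begin

record 'a sgraph =
  verts :: "'a set"
  edges :: "'a set set"

definition finite_simple_graph :: "'a sgraph \<Rightarrow> bool" where
  "finite_simple_graph X \<longleftrightarrow>
     finite (verts X) \<and> (\<forall>e\<in>edges X. e \<subseteq> verts X \<and> card e = 2)"

definition adj :: "'a sgraph \<Rightarrow> 'a \<Rightarrow> 'a \<Rightarrow> bool" where
  "adj X u v \<longleftrightarrow> {u, v} \<in> edges X"

definition walk :: "'a sgraph \<Rightarrow> 'a \<Rightarrow> 'a list \<Rightarrow> 'a \<Rightarrow> bool" where
  "walk X u p v \<longleftrightarrow>
     p \<noteq> [] \<and> hd p = u \<and> last p = v \<and> set p \<subseteq> verts X \<and> successively (adj X) p"

definition connected_graph :: "'a sgraph \<Rightarrow> bool" where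
  "connected_graph X \<longleftrightarrow> (\<forall>u\<in>verts X. \<forall>v\<in>verts X. \<exists>p. walk X u p v)"

text \<open>A walk visiting k + 1 vertices has length k. The distance is meaningful only
  between vertices joined by a walk.\<close>

definition gdist :: "'a sgraph \<Rightarrow> 'a \<Rightarrow> 'a \<Rightarrow> nat" where
  "gdist X u v = (LEAST k. \<exists>p. walk X u p v \<and> length p = k + 1)"

definition n_closer :: "'a sgraph \<Rightarrow> 'a \<Rightarrow> 'a \<Rightarrow> nat" where
  "n_closer X u v = card {w \<in> verts X. gdist X w u < gdist X w v}"

text \<open>Edges are unordered: for an end u of e, the other end is the unique element of
  \<open>e - {u}\<close>, so the inner product has exactly the two factors \<open>n_closer X u v\<close> and
  \<open>n_closer X v u\<close> for \<open>e = {u, v}\<close>.\<close>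

definition szeged :: "'a sgraph \<Rightarrow> nat" where
  "szeged X = (\<Sum>e\<in>edges X. \<Prod>u\<in>e. n_closer X u (the_elem (e - {u})))"

lemma szeged_summand:
  assumes "u \<noteq> v"
  shows "(\<Prod>w\<in>{u, v}. n_closer X w (the_elem ({u, v} - {w}))) = n_closer X u v * n_closer X v u"
proof -
  have "{u, v} - {u} = {v}" "{u, v} - {v} = {u}" using assms by auto
  then show ?thesis using assms by simp
qed

definition complete_graph :: "nat \<Rightarrow> nat sgraph" where
  "complete_graph n = \<lparr>verts = {..<n}, edges = {e. e \<subseteq> {..<n} \<and> card e = 2}\<rparr>"

text \<open>Maps from the vertices of G to the vertices of H are represented by extensional
  functions, so that each map is counted once.\<close>

definition wreath_verts :: "'a sgraph \<Rightarrow> 'b sgraph \<Rightarrow> (('a \<Rightarrow> 'b) \<times> 'a) set" where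
  "wreath_verts G H = (verts G \<rightarrow>\<^sub>E verts H) \<times> verts G"

definition wreath_adj ::
  "'a sgraph \<Rightarrow> 'b sgraph \<Rightarrow> ('a \<Rightarrow> 'b) \<times> 'a \<Rightarrow> ('a \<Rightarrow> 'b) \<times> 'a \<Rightarrow> bool" where
  "wreath_adj G H = (\<lambda>(f, v) (f', v').
     (v = v' \<and> (\<forall>w\<in>verts G. w \<noteq> v \<longrightarrow> f w = f' w) \<and> adj H (f v) (f' v)) \<or>
     (f = f' \<and> adj G v v'))"

definition wreath :: "'a sgraph \<Rightarrow> 'b sgraph \<Rightarrow> (('a \<Rightarrow> 'b) \<times> 'a) sgraph" where
  "wreath G H =
     \<lparr>verts = wreath_verts G H,
      edges = {{x, y} | x y. x \<in> wreath_verts G H \<and> y \<in> wreath_verts G H \<and> wreath_adj G H x y}\<rparr>"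

end

theory Submission
  imports Defs
begin

text \<open>
  Think of a vertex \<open>(f, v)\<close> as a lamplighter at \<open>v\<close> with lamp configuration \<open>f\<close>. The distance
  from \<open>(f, v)\<close> to \<open>(g, u)\<close> is the sum of the distances from \<open>f i\<close> to \<open>g i\<close> in \<open>H\<close>
  plus the length of a shortest walk in the complete graph from \<open>v\<close> to \<open>u\<close> through all \<open>i\<close>
  with \<open>f i \<noteq> g i\<close>. Along an edge that changes the lamp at \<open>v\<close> the walk has the same length
  for both ends, since it ends at \<open>v\<close> anyway; hence only the \<open>H\<close>-distance at \<open>v\<close> matters, and
  these edges contribute the multiple of the Szeged index of \<open>H\<close>. Along an edge that moves the
  lamplighter only the walk lengths matter, and the vertices closer to one end are counted by
  their position and by which lamps differ.
\<close>

subsection \<open>Distances in graphs\<close>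

lemma adj_commute: "adj X u v \<longleftrightarrow> adj X v u"
  by (simp add: adj_def insert_commute)

lemma adj_vertsD:
  assumes "finite_simple_graph X" "adj X u v"
  shows "u \<in> verts X" "v \<in> verts X" "u \<noteq> v"
  using assms by (auto simp: finite_simple_graph_def adj_def)

lemma walk_singleton: "u \<in> verts X \<Longrightarrow> walk X u [u] u"
  by (simp add: walk_def)

lemma walk_Cons:
  "walk X x (a # p) t \<longleftrightarrow>
     a = x \<and> x \<in> verts X \<and> (if p = [] then x = t else adj X x (hd p) \<and> walk X (hd p) p t)"
  by (cases p) (auto simp: walk_def)

lemma walk_ConsI: "x \<in> verts X \<Longrightarrow> adj X x y \<Longrightarrow> walk X y p t \<Longrightarrow> walk X x (x # p) t"
  by (cases p) (auto simp: walk_def)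

lemma gdist_le: "walk X u p v \<Longrightarrow> gdist X u v \<le> length p - 1"
  unfolding gdist_def by (rule Least_le) (auto simp: walk_def intro!: exI[of _ p])

lemma obtain_shortest_walk:
  assumes "walk X u q v"
  obtains p where "walk X u p v" "length p = gdist X u v + 1"
proof -
  have "\<exists>k p. walk X u p v \<and> length p = k + 1"
    using assms by (intro exI[of _ "length q - 1"] exI[of _ q]) (auto simp: walk_def)
  then have "\<exists>p. walk X u p v \<and> length p = gdist X u v + 1"
    unfolding gdist_def by (rule LeastI_ex)
  then show thesis using that by blast
qed

lemma gdist_refl: "u \<in> verts X \<Longrightarrow> gdist X u u = 0"
  using gdist_le[OF walk_singleton, of u X] by simp

text \<open>Prepending \<open>x\<close> to a shortest walk from \<open>y\<close> gives the bound.
  Connectedness ensures that such a walk exists, so that the \<open>LEAST\<close> in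
  \<open>gdist\<close> is attained.\<close>

lemma gdist_step:
  assumes "connected_graph X" "x \<in> verts X" "y \<in> verts X" "t \<in> verts X" "adj X x y"
  shows "gdist X x t \<le> gdist X y t + 1"
proof -
  from assms obtain q where "walk X y q t" unfolding connected_graph_def by blast
  then obtain p where p: "walk X y p t" "length p = gdist X y t + 1"
    by (rule obtain_shortest_walk)
  then have "walk X x (x # p) t" using assms by (blast intro: walk_ConsI)
  from gdist_le[OF this] p show ?thesis by simp
qed

lemma gdist_descent:
  assumes "connected_graph X" "x \<in> verts X" "t \<in> verts X" "x \<noteq> t"
  obtains y where "y \<in> verts X" "adj X x y" "gdist X y t < gdist X x t"
proof -
  from assms obtain q where "walk X x q t" unfolding connected_graph_def by blast
  then obtain p where p: "walk X x p t" "length p = gdist X x t + 1"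
    by (rule obtain_shortest_walk)
  then obtain r where r: "p = x # r" by (cases p) (auto simp: walk_def)
  with p assms have "r \<noteq> []" and w: "adj X x (hd r)" "walk X (hd r) r t"
    by (auto simp: walk_Cons split: if_splits)
  have "gdist X (hd r) t < gdist X x t"
    using gdist_le[OF w(2)] p r \<open>r \<noteq> []\<close> by (cases r) auto
  moreover have "hd r \<in> verts X" using w \<open>r \<noteq> []\<close> by (auto simp: walk_def)
  ultimately show thesis using that w by blast
qed

text \<open>A potential certifies the distance to \<open>t\<close>. By \<open>desc\<close>,
  following neighbours of smaller potential yields a walk to \<open>t\<close> with at most \<phi> x
  steps; by \<open>lip\<close>, each step of any walk lowers the potential by at most 1, so no walk
  is shorter.\<close>

lemma gdist_eqI:
  fixes \<phi> :: "'a \<Rightarrow> nat"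
  assumes "x \<in> verts X" "t \<in> verts X" "\<phi> t = 0"
    and lip: "\<And>x y. x \<in> verts X \<Longrightarrow> y \<in> verts X \<Longrightarrow> adj X x y \<Longrightarrow> \<phi> x \<le> \<phi> y + 1"
    and desc: "\<And>x. x \<in> verts X \<Longrightarrow> x \<noteq> t \<Longrightarrow> \<exists>y\<in>verts X. adj X x y \<and> \<phi> y < \<phi> x"
  shows "gdist X x t = \<phi> x"
proof -
  have "\<exists>p. walk X x p t \<and> length p \<le> \<phi> x + 1"
    using \<open>x \<in> verts X\<close>
  proof (induction "\<phi> x" arbitrary: x rule: less_induct)
    case less
    show ?case
    proof (cases "x = t")
      case True
      then show ?thesis using less.prems walk_singleton by fastforce
    next
      case False
      with desc less.prems obtain y where y: "y \<in> verts X" "adj X x y" "\<phi> y < \<phi> x" by blast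
      with less.hyps obtain p where p: "walk X y p t" "length p \<le> \<phi> y + 1" by blast
      then have "walk X x (x # p) t" using y less.prems by (blast intro: walk_ConsI)
      with p y show ?thesis by (intro exI[of _ "x # p"]) auto
    qed
  qed
  then obtain q where q: "walk X x q t" "length q \<le> \<phi> x + 1" by blast
  have lower: "\<phi> x + 1 \<le> length p" if "walk X x p t" for p x
    using that
  proof (induction p arbitrary: x)
    case Nil
    then show ?case by (simp add: walk_def)
  next
    case (Cons a p)
    show ?case
    proof (cases "p = []")
      case True
      with Cons.prems \<open>\<phi> t = 0\<close> show ?thesis by (simp add: walk_Cons)
    next
      case False
      with Cons.prems have w: "x \<in> verts X" "adj X x (hd p)" "walk X (hd p) p t"
        by (auto simp: walk_Cons)
      then have "hd p \<in> verts X" using False by (auto simp: walk_def)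
      with lip[of x "hd p"] w Cons.IH[of "hd p"] show ?thesis by auto
    qed
  qed
  from obtain_shortest_walk[OF q(1)] obtain p where
    "walk X x p t" "length p = gdist X x t + 1" .
  with lower gdist_le[OF q(1)] q(2) show ?thesis by fastforce
qed

text \<open>Each edge is the image of exactly two ordered pairs, with equal products. Sums over
  ordered pairs avoid \<open>the_elem\<close> and can be indexed by plain tuples.\<close>

lemma double_szeged_eq_sum_arcs:
  assumes "finite_simple_graph X"
  shows "2 * szeged X = (\<Sum>(x, y) | adj X x y. n_closer X x y * n_closer X y x)"
proof -
  let ?P = "{(x, y). adj X x y}" and ?g = "\<lambda>(x, y). n_closer X x y * n_closer X y x"
  have "?P \<subseteq> verts X \<times> verts X" using adj_vertsD[OF assms] by auto
  then have finP: "finite ?P"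
    using assms by (meson finite_SigmaI finite_simple_graph_def finite_subset)
  have finE: "finite (edges X)"
    using assms by (auto simp: finite_simple_graph_def intro: finite_subset[of _ "Pow (verts X)"])
  have "sum ?g ?P = (\<Sum>e\<in>edges X. sum ?g {p \<in> ?P. (\<lambda>(x, y). {x, y}) p = e})"
    using finP finE by (intro sum.group[symmetric]) (auto simp: adj_def)
  also have "\<dots> = (\<Sum>e\<in>edges X. 2 * (\<Prod>u\<in>e. n_closer X u (the_elem (e - {u}))))"
  proof (rule sum.cong[OF refl])
    fix e assume e: "e \<in> edges X"
    with assms obtain u v where uv: "e = {u, v}" "u \<noteq> v"
      by (auto simp: finite_simple_graph_def card_2_iff)
    have "{p \<in> ?P. (\<lambda>(x, y). {x, y}) p = e} = {(u, v), (v, u)}"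
      using e uv by (auto simp: adj_def doubleton_eq_iff insert_commute)
    then show "sum ?g {p \<in> ?P. (\<lambda>(x, y). {x, y}) p = e}
        = 2 * (\<Prod>u\<in>e. n_closer X u (the_elem (e - {u})))"
      unfolding uv(1) szeged_summand[OF uv(2)] using uv by simp
  qed
  finally show ?thesis by (simp add: szeged_def sum_distrib_left)
qed

subsection \<open>Counting functions\<close>

text \<open>A condition on a single coordinate is absorbed into the family of ranges, so that
  \<open>card_PiE\<close> can count the functions satisfying it.\<close>

lemma PiE_fun_upd_subset:
  assumes "i \<in> I" "A \<subseteq> B i"
  shows "PiE I (B(i := A)) = {f \<in> PiE I B. f i \<in> A}"
proof (intro equalityI subsetI)
  fix f assume f: "f \<in> PiE I (B(i := A))"
  have "f k \<in> B k" if "k \<in> I" for k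
    using PiE_mem[OF f that] assms by (cases "k = i") auto
  moreover have "f i \<in> A" using PiE_mem[OF f assms(1)] by simp
  ultimately show "f \<in> {f \<in> PiE I B. f i \<in> A}" using f by (auto simp: PiE_iff)
next
  fix f assume "f \<in> {f \<in> PiE I B. f i \<in> A}"
  then show "f \<in> PiE I (B(i := A))" by (auto simp: PiE_iff)
qed

lemma card_PiE_update:
  assumes "finite I" "i \<in> I"
  shows "card (PiE I ((\<lambda>_. V)(i := A))) = card A * card V ^ (card I - 1)"
  using assms by (simp add: card_PiE prod.remove[of I i])

lemma card_PiE_update2:
  assumes "finite I" "i \<in> I" "j \<in> I" "i \<noteq> j"
  shows "card (PiE I ((\<lambda>_. V)(i := A, j := B))) = card A * card B * card V ^ (card I - 2)"
proof -
  have "card (PiE I ((\<lambda>_. V)(i := A, j := B))) =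
      card B * (card A * (\<Prod>k\<in>I - {j} - {i}. card V))"
    using assms by (simp add: card_PiE prod.remove[of I j] prod.remove[of "I - {j}" i])
  then show ?thesis using assms by (simp add: card_Diff_singleton numeral_2_eq_2)
qed

text \<open>Group the functions by their value at \<open>i\<close>: each value leaves the other
  \<open>card I - 1\<close> coordinates free.\<close>

lemma sum_PiE_component:
  fixes F :: "'b \<Rightarrow> nat"
  assumes "finite I" "i \<in> I" "finite V"
  shows "(\<Sum>f\<in>I \<rightarrow>\<^sub>E V. F (f i)) = card V ^ (card I - 1) * (\<Sum>a\<in>V. F a)"
proof -
  have "(\<Sum>f\<in>I \<rightarrow>\<^sub>E V. F (f i)) = (\<Sum>a\<in>V. \<Sum>f | f \<in> (I \<rightarrow>\<^sub>E V) \<and> f i = a. F (f i))"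
    using assms by (intro sum.group[symmetric]) (auto intro: finite_PiE)
  also have "\<dots> = (\<Sum>a\<in>V. card V ^ (card I - 1) * F a)"
  proof (rule sum.cong[OF refl])
    fix a assume "a \<in> V"
    then have "{f. f \<in> (I \<rightarrow>\<^sub>E V) \<and> f i = a} = PiE I ((\<lambda>_. V)(i := {a}))"
      using assms by (subst PiE_fun_upd_subset) auto
    then have "card {f. f \<in> (I \<rightarrow>\<^sub>E V) \<and> f i = a} = card V ^ (card I - 1)"
      using assms by (simp add: card_PiE_update)
    then show "(\<Sum>f | f \<in> (I \<rightarrow>\<^sub>E V) \<and> f i = a. F (f i)) = card V ^ (card I - 1) * F a"
      by simp
  qed
  finally show ?thesis by (simp add: sum_distrib_left)
qed

lemma card_Times_filter:
  assumes "finite A" "finite B"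
  shows "card {(a, b) \<in> A \<times> B. P a b} = (\<Sum>b\<in>B. card {a \<in> A. P a b})"
proof -
  have "{(a, b) \<in> A \<times> B. P a b} = prod.swap ` (SIGMA b:B. {a \<in> A. P a b})"
    by (auto simp: image_iff)
  then show ?thesis using assms by (simp add: card_image)
qed

subsection \<open>The wreath product with a complete graph\<close>

lemma verts_complete_graph [simp]: "verts (complete_graph n) = {..<n}"
  by (simp add: complete_graph_def)

lemma adj_complete_graph: "adj (complete_graph n) u v \<longleftrightarrow> u < n \<and> v < n \<and> u \<noteq> v"
  by (auto simp: adj_def complete_graph_def card_2_iff doubleton_eq_iff)

lemma finite_simple_complete_graph: "finite_simple_graph (complete_graph n)"
  by (simp add: finite_simple_graph_def complete_graph_def)

lemma verts_wreath [simp]: "verts (wreath G H) = (verts G \<rightarrow>\<^sub>E verts H) \<times> verts G"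
  by (simp add: wreath_def wreath_verts_def)

lemma adj_wreath:
  "adj (wreath G H) (f, v) (f', v') \<longleftrightarrow>
     (f, v) \<in> verts (wreath G H) \<and> (f', v') \<in> verts (wreath G H) \<and>
     (v = v' \<and> (\<forall>w\<in>verts G. w \<noteq> v \<longrightarrow> f w = f' w) \<and> adj H (f v) (f' v) \<or>
      f = f' \<and> adj G v v')"
proof -
  \<comment> \<open>An edge is an unordered pair and may arise from either order of its ends;
    symmetry of \<open>wreath_adj\<close> makes the two readings agree.\<close>
  have sym: "wreath_adj G H x y \<longleftrightarrow> wreath_adj G H y x" for x y
    by (cases x; cases y) (auto simp: wreath_adj_def adj_commute)
  have "adj (wreath G H) x y \<longleftrightarrow>
      x \<in> verts (wreath G H) \<and> y \<in> verts (wreath G H) \<and> wreath_adj G H x y" for x y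
    using sym[of x y] unfolding adj_def wreath_def
    by (simp del: split_paired_Ex add: doubleton_eq_iff) blast
  then show ?thesis by (simp add: wreath_adj_def)
qed

lemma finite_simple_wreath:
  assumes "finite_simple_graph G" "finite_simple_graph H"
  shows "finite_simple_graph (wreath G H)"
proof -
  have "x \<noteq> y" if "wreath_adj G H x y" for x y
    using that adj_vertsD(3)[OF assms(1)] adj_vertsD(3)[OF assms(2)]
    by (cases x; cases y) (auto simp: wreath_adj_def)
  then show ?thesis using assms
    by (auto simp: finite_simple_graph_def wreath_def wreath_verts_def intro!: finite_PiE)
qed

section \<open>Tour lengths in a complete graph\<close>

text \<open>The least number of steps of a walk in a complete graph from \<open>v\<close> to \<open>u\<close> that visits all
  of \<open>D\<close>.\<close>

definition tour :: "'a \<Rightarrow> 'a \<Rightarrow> 'a set \<Rightarrow> nat" where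
  "tour v u D = (if v = u \<and> D \<subseteq> {v} then 0 else card (D - {v, u}) + 1)"

text \<open>The start \<open>v\<close> is visited anyway, so its membership in \<open>D\<close> does
  not matter. The next lemma is the same remark for the final site.\<close>

lemma tour_cong: "D - {v} = D' - {v} \<Longrightarrow> tour v u D = tour v u D'"
proof -
  assume *: "D - {v} = D' - {v}"
  then have "D - {v, u} = D' - {v, u}" by blast
  moreover have "D \<subseteq> {v} \<longleftrightarrow> D' \<subseteq> {v}" using * by blast
  ultimately show ?thesis by (auto simp: tour_def)
qed

lemma tour_cong_end: "D - {u} = D' - {u} \<Longrightarrow> tour v u D = tour v u D'"
proof -
  assume *: "D - {u} = D' - {u}"
  then have "D - {v, u} = D' - {v, u}" by blast
  moreover have "v = u \<Longrightarrow> D \<subseteq> {v} \<longleftrightarrow> D' \<subseteq> {v}" using * by blast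
  ultimately show ?thesis by (auto simp: tour_def)
qed

lemma tour_step:
  assumes "finite D"
  shows "tour v u D \<le> tour v' u D + 1"
proof -
  have "card (D - {v, u}) \<le> card (insert v' (D - {v', u}))"
    using assms by (intro card_mono) auto
  also have "\<dots> \<le> card (D - {v', u}) + 1"
    using assms by (simp add: card_insert_if)
  finally have "card (D - {v, u}) \<le> card (D - {v', u}) + 1" .
  \<comment> \<open>When the tour from \<open>v'\<close> has length 0, its formula lacks the summand
    1, and the cardinality bound above alone would be off by one.\<close>
  moreover have "card (D - {v, u}) = 0" if "v' = u" "D \<subseteq> {u}"
  proof -
    have "D - {v, u} = {}" using that by blast
    then show ?thesis by (simp only: card.empty)
  qed
  ultimately show ?thesis by (auto simp: tour_def)
qed

text \<open>Moving to \<open>w\<close> removes it from the sites still to be visited, while leaving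
  \<open>v\<close> adds none because \<open>v\<close> is not in \<open>D\<close>.\<close>

lemma tour_move:
  assumes "finite D" "v \<notin> D" "w \<in> D" "w \<noteq> u"
  shows "tour w u D < tour v u D"
proof -
  have "D - {w, u} = (D - {v, u}) - {w}" "w \<in> D - {v, u}" using assms by auto
  then have "card (D - {w, u}) < card (D - {v, u})"
    using assms by (metis card_Diff1_less finite_Diff)
  then show ?thesis using assms by (auto simp: tour_def)
qed

section \<open>Distances in the wreath product\<close>

text \<open>The right-hand side is a potential in the sense of \<open>gdist_eqI\<close>: a lamp
  change affects only the lamp sum, by at most 1 per step towards the target, and a move affects
  only the tour.\<close>

lemma gdist_wreath_complete:
  assumes H: "finite_simple_graph H" "connected_graph H"
    and x: "(f, v) \<in> verts (wreath (complete_graph n) H)"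
    and t: "(g, u) \<in> verts (wreath (complete_graph n) H)"
  shows "gdist (wreath (complete_graph n) H) (f, v) (g, u) =
    (\<Sum>i<n. gdist H (f i) (g i)) + tour v u {i. i < n \<and> f i \<noteq> g i}"
proof -
  let ?W = "wreath (complete_graph n) H"
  define S where "S f = (\<Sum>i<n. gdist H (f i) (g i))" for f
  define D where "D f = {i. i < n \<and> f i \<noteq> g i}" for f
  define \<phi> where "\<phi> = (\<lambda>(f, v). S f + tour v u (D f))"
  have fin: "finite (D f)" for f by (simp add: D_def)
  have g: "g \<in> {..<n} \<rightarrow>\<^sub>E verts H" "u < n" using t by auto
  have S_split: "S f = gdist H (f v) (g v) + (\<Sum>i\<in>{..<n} - {v}. gdist H (f i) (g i))"
    if "v < n" for f v
    unfolding S_def using that by (simp add: sum.remove[of _ v])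
  \<comment> \<open>Changing the lamp at the current position \<open>v\<close> changes
    \<open>D f\<close> at most in \<open>v\<close>, so the tour starting there keeps its
    length.\<close>
  have off_lamp: "tour v u (D f) = tour v u (D f')"
    "(\<Sum>i\<in>{..<n} - {v}. gdist H (f i) (g i)) = (\<Sum>i\<in>{..<n} - {v}. gdist H (f' i) (g i))"
    if "\<forall>i<n. i \<noteq> v \<longrightarrow> f i = f' i" for f f' v
    using that by (auto simp: D_def intro!: tour_cong sum.cong)
  have "gdist ?W (f, v) (g, u) = \<phi> (f, v)"
  proof (rule gdist_eqI)
    have "S g = 0" unfolding S_def using g by (auto intro!: gdist_refl)
    then show "\<phi> (g, u) = 0" by (simp add: \<phi>_def D_def tour_def)
  next
    fix x y assume "adj ?W x y"
    moreover obtain f v f' v' where xy: "x = (f, v)" "y = (f', v')" by (cases x; cases y)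
    ultimately consider
      (lamp) "v = v'" "\<forall>i<n. i \<noteq> v \<longrightarrow> f i = f' i" "adj H (f v) (f' v)" "v < n"
    | (move) "f = f'"
      by (auto simp: adj_wreath)
    then show "\<phi> x \<le> \<phi> y + 1"
    proof cases
      case lamp
      have "gdist H (f v) (g v) \<le> gdist H (f' v) (g v) + 1"
        using lamp g adj_vertsD[OF H(1) lamp(3)] by (intro gdist_step H) auto
      then show ?thesis
        using lamp(1) lamp(4) off_lamp[OF lamp(2)]
        by (simp add: \<phi>_def xy S_split[of v])
    next
      case move
      then show ?thesis using tour_step[OF fin] by (simp add: \<phi>_def xy)
    qed
  next
    fix x assume "x \<in> verts ?W" "x \<noteq> (g, u)"
    then obtain f v where xf: "x = (f, v)" "f \<in> {..<n} \<rightarrow>\<^sub>E verts H" "v < n" "(f, v) \<noteq> (g, u)"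
      by auto
    have goal: "\<exists>y\<in>verts ?W. adj ?W x y \<and> \<phi> y < \<phi> x"
      if "w < n" "w \<noteq> v" "tour w u (D f) < tour v u (D f)" for w
      using that xf by (intro bexI[of _ "(f, w)"]) (auto simp: adj_wreath adj_complete_graph \<phi>_def)
    show "\<exists>y\<in>verts ?W. adj ?W x y \<and> \<phi> y < \<phi> x"
    \<comment> \<open>Descent strategy: correct the lamp at the current position first, then visit a
      wrong lamp away from \<open>u\<close>, and go to \<open>u\<close> only when no other wrong
      lamp is left.\<close>
    proof (cases "f v = g v")
      case False
      have "f v \<in> verts H" "g v \<in> verts H" using xf g by auto
      with False obtain b where b: "b \<in> verts H" "adj H (f v) b"
        "gdist H b (g v) < gdist H (f v) (g v)"
        using gdist_descent[OF H(2)] by metis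
      let ?f = "f(v := b)"
      have "?f \<in> {..<n} \<rightarrow>\<^sub>E verts H" using xf b by (auto simp: PiE_iff extensional_def)
      then have "adj ?W x (?f, v)" using xf b by (auto simp: adj_wreath)
      moreover have "\<phi> (?f, v) < \<phi> x"
        using off_lamp[of v f ?f] b xf by (simp add: \<phi>_def S_split[of v])
      ultimately show ?thesis using \<open>?f \<in> _\<close> xf by (intro bexI[of _ "(?f, v)"]) auto
    next
      case True
      then have vD: "v \<notin> D f" by (simp add: D_def)
      show ?thesis
      proof (cases "D f \<subseteq> {u}")
        case True
        \<comment> \<open>Otherwise all lamps agree with \<open>g\<close> and \<open>x\<close> is
          already the target. Hence the tour length is 1, and stepping to \<open>u\<close> makes it
          0 even if the lamp at \<open>u\<close> is still wrong.\<close>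
        have "v \<noteq> u"
        proof
          assume "v = u"
          with True vD have "D f = {}" by auto
          then have "f = g" using xf g by (intro PiE_ext[of f _ _ g]) (auto simp: D_def)
          with \<open>v = u\<close> xf show False by simp
        qed
        with True show ?thesis using g by (intro goal[of u]) (auto simp: tour_def)
      next
        case False
        then obtain w where w: "w \<in> D f" "w \<noteq> u" by blast
        then show ?thesis using vD tour_move[OF fin vD w] by (intro goal[of w]) (auto simp: D_def)
      qed
    qed
  qed (use x t in auto)
  then show ?thesis by (simp add: \<phi>_def S_def D_def)
qed

section \<open>Vertices closer to one end of an edge\<close>

text \<open>The tour ends at \<open>v\<close> for both ends of the edge, so it contributes the same
  amount to both distances, as do all lamps other than \<open>v\<close>. The comparison thus depends
  on the lamp at \<open>v\<close> alone; the position gives the factor \<open>n\<close>, the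
  remaining lamps the power.\<close>

lemma n_closer_wreath_lamp:
  assumes H: "finite_simple_graph H" "connected_graph H"
    and adj: "adj H (f v) b" and f: "f \<in> {..<n} \<rightarrow>\<^sub>E verts H" and v: "v < n"
  shows "n_closer (wreath (complete_graph n) H) (f, v) (f(v := b), v) =
      n * card (verts H) ^ (n - 1) * n_closer H (f v) b"
    and "n_closer (wreath (complete_graph n) H) (f(v := b), v) (f, v) =
      n * card (verts H) ^ (n - 1) * n_closer H b (f v)"
proof -
  let ?W = "wreath (complete_graph n) H" and ?V = "verts H"
  have b: "b \<in> ?V" using adj_vertsD[OF H(1) adj] by simp
  let ?f = "f(v := b)"
  have f': "?f \<in> {..<n} \<rightarrow>\<^sub>E ?V" using f b v by (auto simp: PiE_iff extensional_def)
  have dist: "\<exists>k. gdist ?W x (f, v) = gdist H (fst x v) (f v) + k \<and>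
      gdist ?W x (?f, v) = gdist H (fst x v) b + k"
    if xW: "x \<in> verts ?W" for x
  proof -
    obtain g w where x: "x = (g, w)" "g \<in> {..<n} \<rightarrow>\<^sub>E ?V" "w < n"
      using xW by (cases x) simp
    have "tour w v {i. i < n \<and> g i \<noteq> f i} = tour w v {i. i < n \<and> g i \<noteq> ?f i}"
      by (rule tour_cong_end) auto
    moreover have "(\<Sum>i<n. gdist H (g i) (h i)) =
        gdist H (g v) (h v) + (\<Sum>i\<in>{..<n} - {v}. gdist H (g i) (h i))" for h
      using v by (simp add: sum.remove[of _ v])
    moreover have "(\<Sum>i\<in>{..<n} - {v}. gdist H (g i) (?f i)) =
        (\<Sum>i\<in>{..<n} - {v}. gdist H (g i) (f i))"
      by (intro sum.cong) auto
    ultimately show ?thesis using x f f' v by (simp add: gdist_wreath_complete[OF H])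
  qed
  have count: "card {x \<in> verts ?W. P (fst x v)} = n * card ?V ^ (n - 1) * card {a \<in> ?V. P a}" for P
  proof -
    have "{x \<in> verts ?W. P (fst x v)} = {g \<in> {..<n} \<rightarrow>\<^sub>E ?V. P (g v)} \<times> {..<n}"
      by (rule set_eqI) (simp add: mem_Times_iff conj_ac)
    also have "{g \<in> {..<n} \<rightarrow>\<^sub>E ?V. P (g v)} = PiE {..<n} ((\<lambda>_. ?V)(v := {a \<in> ?V. P a}))"
      using v by (subst PiE_fun_upd_subset) auto
    finally show ?thesis using v by (simp add: card_cartesian_product card_PiE_update)
  qed
  have "{x \<in> verts ?W. gdist ?W x (f, v) < gdist ?W x (?f, v)} =
      {x \<in> verts ?W. gdist H (fst x v) (f v) < gdist H (fst x v) b}"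
  proof (intro Collect_cong conj_cong refl)
    fix x assume "x \<in> verts ?W"
    with dist obtain k where "gdist ?W x (f, v) = gdist H (fst x v) (f v) + k"
      "gdist ?W x (?f, v) = gdist H (fst x v) b + k" by blast
    then show "gdist ?W x (f, v) < gdist ?W x (?f, v) \<longleftrightarrow>
        gdist H (fst x v) (f v) < gdist H (fst x v) b"
      by simp
  qed
  then show "n_closer ?W (f, v) (?f, v) = n * card ?V ^ (n - 1) * n_closer H (f v) b"
    unfolding n_closer_def by (simp only: count[of "\<lambda>c. gdist H c (f v) < gdist H c b"])
  have "{x \<in> verts ?W. gdist ?W x (?f, v) < gdist ?W x (f, v)} =
      {x \<in> verts ?W. gdist H (fst x v) b < gdist H (fst x v) (f v)}"
  proof (intro Collect_cong conj_cong refl)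
    fix x assume "x \<in> verts ?W"
    with dist obtain k where "gdist ?W x (f, v) = gdist H (fst x v) (f v) + k"
      "gdist ?W x (?f, v) = gdist H (fst x v) b + k" by blast
    then show "gdist ?W x (?f, v) < gdist ?W x (f, v) \<longleftrightarrow>
        gdist H (fst x v) b < gdist H (fst x v) (f v)"
      by simp
  qed
  then show "n_closer ?W (?f, v) (f, v) = n * card ?V ^ (n - 1) * n_closer H b (f v)"
    unfolding n_closer_def by (simp only: count[of "\<lambda>c. gdist H c b < gdist H c (f v)"])
qed

text \<open>For distinct start and end, ending at a site of \<open>D\<close> saves one visit. A tour
  that returns to its start has no such saving, but has length 0 if nothing else is to be
  visited.\<close>

lemma tour_less_iff:
  assumes "finite D" "v \<noteq> u"
  shows "tour w v D < tour w u D \<longleftrightarrow>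
    (if w = v then D \<subseteq> {v} else if w = u then v \<in> D else v \<in> D \<and> u \<notin> D)"
proof -
  have rem: "card (D - {w, x}) = card (D - {w}) - (if x \<in> D \<and> x \<noteq> w then 1 else 0)" for x w
  proof -
    have "D - {w, x} = D - {w} - {x}" by auto
    then show ?thesis using assms(1) by (simp add: card_Diff_singleton_if)
  qed
  \<comment> \<open>Guards against truncation when \<open>rem\<close> subtracts 1.\<close>
  have pos: "card (D - {w}) > 0" if "x \<in> D" "x \<noteq> w" for x w
    using that assms(1) by (auto simp: card_gt_0_iff)
  consider "w = v" | "w = u" | "w \<noteq> v" "w \<noteq> u" by blast
  then show ?thesis
  proof cases
    case 1
    then show ?thesis using assms rem[of v v] rem[of v u] pos[of u v]
      by (auto simp: tour_def)
  next
    case 2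
    then show ?thesis using assms rem[of u v] rem[of u u] pos[of v u]
      by (auto simp: tour_def)
  next
    case 3
    then show ?thesis using assms rem[of w v] rem[of w u] pos[of v w] pos[of u w]
      by (auto simp: tour_def)
  qed
qed

text \<open>The lamp sums cancel, leaving a comparison of tours. The three summands count
  lamplighters at \<open>v\<close> (only the lamp at \<open>v\<close> is free), at \<open>u\<close>
  (the lamp at \<open>v\<close> must differ), and at the other \<open>n - 2\<close> sites (the lamp
  at \<open>v\<close> differs, the one at \<open>u\<close> agrees).\<close>

lemma n_closer_wreath_move:
  assumes H: "finite_simple_graph H" "connected_graph H"
    and f: "f \<in> {..<n} \<rightarrow>\<^sub>E verts H" and vu: "v < n" "u < n" "v \<noteq> u"
    and m: "card (verts H) = m"
  shows "n_closer (wreath (complete_graph n) H) (f, v) (f, u) =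
      m + (m - 1) * m ^ (n - 1) + (n - 2) * ((m - 1) * m ^ (n - 2))"
proof -
  let ?W = "wreath (complete_graph n) H" and ?V = "verts H"
  let ?F = "{..<n} \<rightarrow>\<^sub>E ?V"
  let ?D = "\<lambda>g. {i. i < n \<and> g i \<noteq> f i}"
  \<comment> \<open>The criterion of \<open>tour_less_iff\<close> for the set of sites where
    \<open>g\<close> and \<open>f\<close> differ.\<close>
  define P where "P g w \<longleftrightarrow> (if w = v then \<forall>i<n. i \<noteq> v \<longrightarrow> g i = f i
    else if w = u then g v \<noteq> f v else g v \<noteq> f v \<and> g u = f u)" for g w
  have finV: "finite ?V" using H by (simp add: finite_simple_graph_def)
  have fV: "f i \<in> ?V" if "i < n" for i using f that by auto
  have "gdist ?W (g, w) (f, v) < gdist ?W (g, w) (f, u) \<longleftrightarrow> P g w"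
    if "g \<in> ?F" "w < n" for g w
  proof -
    have "gdist ?W (g, w) (f, v) < gdist ?W (g, w) (f, u) \<longleftrightarrow>
        tour w v (?D g) < tour w u (?D g)"
      using that f vu by (simp add: gdist_wreath_complete[OF H])
    also have "\<dots> \<longleftrightarrow> P g w"
      using vu by (subst tour_less_iff) (auto simp: P_def)
    finally show ?thesis .
  qed
  then have "{x \<in> verts ?W. gdist ?W x (f, v) < gdist ?W x (f, u)} = {(g, w) \<in> ?F \<times> {..<n}. P g w}"
    by auto
  then have "n_closer ?W (f, v) (f, u) = (\<Sum>w<n. card {g \<in> ?F. P g w})"
    unfolding n_closer_def using finV card_Times_filter[of ?F "{..<n}" P] by (simp add: finite_PiE)
  also have "\<dots> = card {g \<in> ?F. P g v} + (card {g \<in> ?F. P g u} +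
      (\<Sum>w\<in>{..<n} - {v} - {u}. card {g \<in> ?F. P g w}))"
    using vu by (simp add: sum.remove[of "{..<n}" v] sum.remove[of "{..<n} - {v}" u])
  also have "card {g \<in> ?F. P g v} = m"
  proof -
    have "{g \<in> ?F. P g v} = PiE {..<n} ((\<lambda>i. {f i})(v := ?V))"
    proof (intro equalityI subsetI)
      fix g assume "g \<in> {g \<in> ?F. P g v}"
      then have g: "g \<in> ?F" "\<And>i. i < n \<Longrightarrow> i \<noteq> v \<Longrightarrow> g i = f i"
        by (simp_all add: P_def)
      then show "g \<in> PiE {..<n} ((\<lambda>i. {f i})(v := ?V))"
        by (simp add: PiE_iff)
    next
      fix g assume g: "g \<in> PiE {..<n} ((\<lambda>i. {f i})(v := ?V))"
      have eq: "g i = f i" if "i < n" "i \<noteq> v" for i using PiE_mem[OF g, of i] that by simp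
      have "g v \<in> ?V" using PiE_mem[OF g, of v] vu by simp
      then have "g i \<in> ?V" if "i < n" for i using eq fV that by (cases "i = v") auto
      then show "g \<in> {g \<in> ?F. P g v}" using g eq by (simp add: PiE_iff P_def)
    qed
    then show ?thesis using vu m by (simp add: card_PiE prod.remove[of "{..<n}" v])
  qed
  also have "card {g \<in> ?F. P g u} = (m - 1) * m ^ (n - 1)"
  proof -
    have "{g \<in> ?F. P g u} = PiE {..<n} ((\<lambda>_. ?V)(v := ?V - {f v}))"
      using vu by (subst PiE_fun_upd_subset) (auto simp: P_def)
    then show ?thesis using vu m finV fV by (simp add: card_PiE_update)
  qed
  also have "(\<Sum>w\<in>{..<n} - {v} - {u}. card {g \<in> ?F. P g w}) = (n - 2) * ((m - 1) * m ^ (n - 2))"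
  proof -
    have "card {g \<in> ?F. P g w} = (m - 1) * m ^ (n - 2)" if "w \<in> {..<n} - {v} - {u}" for w
    proof -
      have "{g \<in> ?F. P g w} = PiE {..<n} ((\<lambda>_. ?V)(v := ?V - {f v}, u := {f u}))"
        using vu that fV by (subst PiE_fun_upd_subset, simp, simp, subst PiE_fun_upd_subset)
          (auto simp: P_def)
      then show ?thesis using vu m finV fV by (simp add: card_PiE_update2)
    qed
    moreover have "card ({..<n} - {v} - {u}) = n - 2" using vu by (simp add: card_Diff_singleton)
    ultimately show ?thesis by simp
  qed
  finally show ?thesis by simp
qed

section \<open>Summation over the two kinds of arcs\<close>

lemma double_szeged_wreath_complete:
  assumes H: "finite_simple_graph H" "connected_graph H" and m: "card (verts H) = m"
  shows "2 * szeged (wreath (complete_graph n) H) =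
      n * (m ^ (n - 1) * ((n * m ^ (n - 1))\<^sup>2 * (2 * szeged H)))
      + m ^ n * (n * (n - 1)) * (m + (m - 1) * m ^ (n - 1) + (n - 2) * ((m - 1) * m ^ (n - 2)))\<^sup>2"
proof -
  let ?W = "wreath (complete_graph n) H" and ?V = "verts H"
  let ?F = "{..<n} \<rightarrow>\<^sub>E ?V"
  let ?g = "\<lambda>(x, y). n_closer ?W x y * n_closer ?W y x"
  define N where "N = n * m ^ (n - 1)"
  define M where "M = m + (m - 1) * m ^ (n - 1) + (n - 2) * ((m - 1) * m ^ (n - 2))"
  have finV: "finite ?V" using H by (simp add: finite_simple_graph_def)
  then have finF: "finite ?F" by (simp add: finite_PiE)
  \<comment> \<open>\<open>A\<close> indexes the arcs that change a lamp, \<open>B\<close> those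
    that move the lamplighter; \<open>?a\<close> and \<open>?b\<close> map the indices to
    arcs.\<close>
  define A where "A = (SIGMA v:{..<n}. SIGMA f:?F. {b. adj H (f v) b})"
  define B where "B = (SIGMA f:?F. SIGMA v:{..<n}. {..<n} - {v})"
  let ?a = "\<lambda>(v, f, b). ((f, v), (f(v := b), v))"
  let ?b = "\<lambda>(f, v, u). ((f, v), (f, u))"
  have nbV: "{b. adj H a b} \<subseteq> ?V" for a using adj_vertsD[OF H(1)] by auto
  have finA: "finite A" unfolding A_def
    using finF finite_subset[OF nbV finV] by (intro finite_SigmaI) auto
  have finB: "finite B" unfolding B_def using finF by (intro finite_SigmaI) auto
  have P: "{(x, y). adj ?W x y} = ?a ` A \<union> ?b ` B"
  proof (intro equalityI subsetI)
    fix p assume "p \<in> {(x, y). adj ?W x y}"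
    then obtain f v f' v' where p: "p = ((f, v), (f', v'))" "adj ?W (f, v) (f', v')"
      by auto
    then have fv: "f \<in> ?F" "f' \<in> ?F" "v < n" "v' < n" by (auto simp: adj_wreath)
    from p consider "v = v'" "\<forall>i<n. i \<noteq> v \<longrightarrow> f i = f' i" "adj H (f v) (f' v)"
      | "f = f'" "v \<noteq> v'"
      by (auto simp: adj_wreath adj_complete_graph)
    then show "p \<in> ?a ` A \<union> ?b ` B"
    proof cases
      case 1
      have "f' = f(v := f' v)"
      proof
        fix i show "f' i = (f(v := f' v)) i"
          using 1 fv by (cases "i < n") (auto simp: PiE_iff extensional_def)
      qed
      then have "p = ?a (v, f, f' v)" using p 1 by simp
      moreover have "(v, f, f' v) \<in> A" using 1 fv by (simp add: A_def)
      ultimately show ?thesis by blast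
    next
      case 2
      then have "p = ?b (f, v, v')" using p by simp
      moreover have "(f, v, v') \<in> B" using 2 fv by (simp add: B_def)
      ultimately show ?thesis by blast
    qed
  next
    fix p assume "p \<in> ?a ` A \<union> ?b ` B"
    then show "p \<in> {(x, y). adj ?W x y}"
    proof
      assume "p \<in> ?a ` A"
      then obtain v f b where *: "p = ((f, v), (f(v := b), v))" "v < n" "f \<in> ?F" "adj H (f v) b"
        by (auto simp: A_def)
      then have "f(v := b) \<in> ?F"
        using adj_vertsD[OF H(1) *(4)] by (auto simp: PiE_iff extensional_def)
      then show ?thesis using * by (auto simp: adj_wreath)
    next
      assume "p \<in> ?b ` B"
      then obtain f v u where "p = ((f, v), (f, u))" "f \<in> ?F" "v < n" "u < n" "v \<noteq> u"
        by (auto simp: B_def)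
      then show ?thesis by (simp add: adj_wreath adj_complete_graph)
    qed
  qed
  have injA: "inj_on ?a A"
    by (auto simp: inj_on_def) (metis fun_upd_same)
  have injB: "inj_on ?b B" by (auto simp: inj_on_def)
  have disj: "?a ` A \<inter> ?b ` B = {}" by (auto simp: B_def)
  have "2 * szeged ?W = sum ?g (?a ` A \<union> ?b ` B)"
    using double_szeged_eq_sum_arcs[OF finite_simple_wreath[OF finite_simple_complete_graph H(1)]]
    by (simp add: P)
  also have "\<dots> = sum ?g (?a ` A) + sum ?g (?b ` B)"
    using finA finB disj by (intro sum.union_disjoint) auto
  also have "sum ?g (?a ` A) = (\<Sum>(v, f, b)\<in>A. N\<^sup>2 * (n_closer H (f v) b * n_closer H b (f v)))"
    unfolding sum.reindex[OF injA]
  proof (intro sum.cong refl)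
    fix p assume "p \<in> A"
    then obtain v f b where "p = (v, f, b)" "v < n" "f \<in> ?F" "adj H (f v) b"
      by (auto simp: A_def)
    then show "(?g \<circ> ?a) p = (case p of (v, f, b) \<Rightarrow> N\<^sup>2 * (n_closer H (f v) b * n_closer H b (f v)))"
      by (simp add: N_def m n_closer_wreath_lamp[OF H] power2_eq_square)
  qed
  also have "\<dots> = (\<Sum>v<n. \<Sum>f\<in>?F. \<Sum>b | adj H (f v) b.
      N\<^sup>2 * (n_closer H (f v) b * n_closer H b (f v)))"
    unfolding A_def using finF finite_subset[OF nbV finV]
    by (subst sum.Sigma[symmetric]; simp add: finite_SigmaI sum.Sigma split_def)
  \<comment> \<open>The inner sum depends on \<open>f\<close> only through \<open>f v\<close>, so
    \<open>sum_PiE_component\<close> applies.\<close>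
  also have "\<dots> = (\<Sum>v<n. m ^ (n - 1) * (\<Sum>a\<in>?V. \<Sum>b | adj H a b.
      N\<^sup>2 * (n_closer H a b * n_closer H b a)))"
    using sum_PiE_component[of "{..<n}" _ ?V "\<lambda>a. \<Sum>b | adj H a b. N\<^sup>2 * (n_closer H a b * n_closer H b a)"]
      finV m by (intro sum.cong) auto
  also have "(\<Sum>a\<in>?V. \<Sum>b | adj H a b. N\<^sup>2 * (n_closer H a b * n_closer H b a)) =
      N\<^sup>2 * (2 * szeged H)"
  proof -
    have "(SIGMA a:?V. {b. adj H a b}) = {(x, y). adj H x y}"
      using adj_vertsD[OF H(1)] by auto
    then show ?thesis
      using finV finite_subset[OF nbV finV]
      by (simp add: double_szeged_eq_sum_arcs[OF H(1)] sum_distrib_left sum.Sigma split_def)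
  qed
  \<comment> \<open>The count in \<open>n_closer_wreath_move\<close> depends on neither
    \<open>f\<close> nor the two positions, so both factors equal \<open>M\<close>.\<close>
  also have "sum ?g (?b ` B) = (\<Sum>p\<in>B. M\<^sup>2)"
    unfolding sum.reindex[OF injB]
  proof (intro sum.cong refl)
    fix p assume "p \<in> B"
    then obtain f v u where "p = (f, v, u)" "f \<in> ?F" "v < n" "u < n" "v \<noteq> u"
      by (auto simp: B_def)
    then show "(?g \<circ> ?b) p = M\<^sup>2"
      by (simp add: M_def n_closer_wreath_move[OF H _ _ _ _ m] power2_eq_square)
  qed
  also have "\<dots> = m ^ n * (n * (n - 1)) * M\<^sup>2"
    unfolding B_def using finF m by (simp add: card_SigmaI card_PiE)
  finally show ?thesis by (simp add: N_def M_def)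
qed

theorem theorem6p16:
  fixes H :: "'a sgraph" and n m :: nat
  assumes "n \<ge> 2"
    and "finite_simple_graph H"
    and "connected_graph H"
    and "card (verts H) = m"
  shows "real (szeged (wreath (complete_graph n) H)) =
      real n ^ 3 * real m ^ (3 * n - 3) * real (szeged H)
      + 1 / 2 * real m ^ n * real n * (real n - 1) *
        (real m + real m ^ (n - 2) *
          (real m ^ 2 + real m * real n - 3 * real m - real n + 2)) ^ 2"
proof -
  obtain k where n: "n = k + 2" using \<open>n \<ge> 2\<close> by (metis add.commute le_Suc_ex)
  \<comment> \<open>Lets \<open>power_mult\<close> write the target power as the cube of
    \<open>m ^ (n - 1)\<close>: one factor counts the other lamps, two come from the squared
    multiplicity.\<close>
  have exp: "3 * n - 3 = (n - 1) * 3" by simp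
  let ?M = "m + (m - 1) * m ^ (n - 1) + (n - 2) * ((m - 1) * m ^ (n - 2))"
  let ?R = "real m + real m ^ (n - 2) * (real m ^ 2 + real m * real n - 3 * real m - real n + 2)"
  \<comment> \<open>The factor \<open>m ^ n\<close> settles \<open>m = 0\<close>, where
    \<open>m - 1\<close> is truncated. For positive \<open>m\<close>, pulling out
    \<open>m ^ (n - 2)\<close> leaves (m - 1) m + (n - 2) (m - 1), which expands to the bracket in
    \<open>?R\<close>.\<close>
  have M: "real m ^ n * (real ?M)\<^sup>2 = real m ^ n * ?R\<^sup>2"
  proof (cases m)
    case 0
    then show ?thesis using n by simp
  next
    case (Suc l)
    then have "real ?M = ?R" by (simp add: n algebra_simps power2_eq_square)
    then show ?thesis by (simp only:)
  qed
  have n1: "real (n - 1) = real n - 1" using n by simp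
  have "2 * real (szeged (wreath (complete_graph n) H)) =
      real (n * (m ^ (n - 1) * ((n * m ^ (n - 1))\<^sup>2 * (2 * szeged H)))
        + m ^ n * (n * (n - 1)) * ?M\<^sup>2)"
    by (subst double_szeged_wreath_complete[OF assms(2-4), symmetric]) simp
  also have "\<dots> = real n * (real m ^ (n - 1) * ((real n * real m ^ (n - 1))\<^sup>2 * (2 * real (szeged H))))
      + real m ^ n * (real n * (real n - 1)) * (real ?M)\<^sup>2"
    by (simp only: of_nat_add[of "n * _"] of_nat_mult[of n] of_nat_mult[of "m ^ _"] of_nat_mult[of 2]
        of_nat_mult[of "_ ^ 2"] of_nat_mult[of _ "_ ^ 2"] of_nat_power of_nat_numeral n1)
  also have "\<dots> = 2 * (real n ^ 3 * real m ^ (3 * n - 3) * real (szeged H))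
      + real n * (real n - 1) * (real m ^ n * (real ?M)\<^sup>2)"
    unfolding exp power_mult by (simp only: power2_eq_square power3_eq_cube mult_ac)
  finally show ?thesis unfolding M by (simp add: mult_ac)
qed

end
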